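(* Let $G$ be a group and let $\alpha\in\operatorname{Aut}(G)$ be inverse ambiguous. Then $G$ is abelian and $\alpha^4=\operatorname{id}$. Moreover, exactly one of the following holds: (i) $\alpha$ has order $4$ (as an element of $\operatorname{Aut}(G)$); (ii) every element of $G$ has order dividing $2$ and $\alpha^2=\operatorname{id}$.
   Context: Let $G$ be a group (finite or infinite). A bijection $f\colon G\to G$ is called inverse ambiguous if $f^{-1}(x)=f(x)^{-1}$ for every $x\in G$, where $f^{-1}(x)$ denotes the preimage of $x$ under $f$ and $f(x)^{-1}$ denotes the inverse of $f(x)$ in $G$. An inverse ambiguous automorphism is a group automorphism that is inverse ambiguous. *)

theory Defs
  imports "HOL-Algebra.Algebra"
begin

(* inv_into (carrier G) f x is the preimage of x under f, whereas inv\<^bsub>G\<^esub> (f x) is the group inverse. *)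
definition inverse_ambiguous :: "('a, 'b) monoid_scheme \<Rightarrow> ('a \<Rightarrow> 'a) \<Rightarrow> bool" where
  "inverse_ambiguous G f \<longleftrightarrow>
     bij_betw f (carrier G) (carrier G) \<and>
     (\<forall>x\<in>carrier G. inv_into (carrier G) f x = inv\<^bsub>G\<^esub> (f x))"

end

theory Submission
  imports Defs
begin

text \<open>
  Applying \<open>\<alpha>\<close> to \<open>\<alpha>\<inverse>(x) = \<alpha>(x)\<inverse>\<close> gives \<open>\<alpha>\<^sup>2(x) = x\<inverse>\<close>. So inversion is an
  automorphism, which forces commutativity, and it is an involution, which gives \<open>\<alpha>\<^sup>4 = id\<close>.
  Hence the order of \<open>\<alpha>\<close> is 4 unless \<open>\<alpha>\<^sup>2\<close>, that is inversion, is trivial.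
\<close>

lemma carrier_AutoGroup: "carrier (AutoGroup G) = hom G G \<inter> Bij (carrier G)"
  by (simp add: AutoGroup_def auto_def)

text \<open>The identity is a restricted function because elements of \<open>Bij\<close> are
  extensional, that is, \<open>undefined\<close> off the carrier.\<close>

lemma one_AutoGroup: "\<one>\<^bsub>AutoGroup G\<^esub> = (\<lambda>x\<in>carrier G. x)"
  by (simp add: AutoGroup_def BijGroup_def)

lemma mult_AutoGroup:
  "\<lbrakk>f \<in> carrier (AutoGroup G); g \<in> carrier (AutoGroup G)\<rbrakk>
    \<Longrightarrow> f \<otimes>\<^bsub>AutoGroup G\<^esub> g = compose (carrier G) f g"
  by (simp add: AutoGroup_def BijGroup_def auto_def)

lemma (in group) inverse_ambiguous_hom_apply_twice:
  assumes "f \<in> hom G G" and "inverse_ambiguous G f" and x: "x \<in> carrier G"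
  shows "f (f x) = inv x"
proof -
  interpret group_hom G G f
    using assms(1) by unfold_locales
  \<comment> \<open>By inverse ambiguity, \<open>inv (f x)\<close> is the preimage of
    \<open>x\<close>. As \<open>f\<close> preserves inverses, this says that \<open>f (f x)\<close>
    has inverse \<open>x\<close>.\<close>
  have "f (inv (f x)) = x"
    using assms unfolding inverse_ambiguous_def
    by (metis bij_betw_inv_into_right)
  then show ?thesis
    using x by (metis hom_closed hom_inv inv_inv)
qed

text \<open>Inversion always reverses products. Being \<open>f\<close> applied twice, it also
  preserves their order here, so the two orders agree.\<close>

lemma (in group) inverse_ambiguous_hom_imp_comm_group:
  assumes hom: "f \<in> hom G G" and amb: "inverse_ambiguous G f"
  shows "comm_group G"
proof (rule group_comm_groupI)
  fix x y assume xy: "x \<in> carrier G" "y \<in> carrier G"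
  note sq = inverse_ambiguous_hom_apply_twice [OF hom amb]
  have "inv (x \<otimes> y) = f (f (x \<otimes> y))"
    using xy by (simp add: sq)
  also have "\<dots> = inv x \<otimes> inv y"
    using xy by (simp add: hom_mult [OF hom] hom_in_carrier [OF hom] sq)
  also have "\<dots> = inv (y \<otimes> x)"
    using xy by (simp add: inv_mult_group)
  finally show "x \<otimes> y = y \<otimes> x"
    using xy by (metis inv_inv m_closed)
qed

lemma (in group) AutoGroup_pow2_inverse_ambiguous:
  assumes "f \<in> carrier (AutoGroup G)" and "inverse_ambiguous G f"
  shows "f [^]\<^bsub>AutoGroup G\<^esub> (2::nat) = (\<lambda>x\<in>carrier G. inv\<^bsub>G\<^esub> x)"
proof -
  interpret A: group "AutoGroup G"
    by (rule AutoGroup)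
  have "f [^]\<^bsub>AutoGroup G\<^esub> (2::nat) = compose (carrier G) f f"
    using assms(1) by (simp add: numeral_2_eq_2 mult_AutoGroup)
  then show ?thesis
    using assms by (auto simp: compose_def carrier_AutoGroup inverse_ambiguous_hom_apply_twice)
qed

text \<open>This translates the exponent condition of case (ii) into the triviality of inversion,
  which is the square of \<open>\<alpha>\<close>.\<close>

lemma (in group) ord_dvd_2_iff_inv_eq:
  assumes "x \<in> carrier G"
  shows "ord x dvd 2 \<longleftrightarrow> inv x = x"
proof -
  have "ord x dvd 2 \<longleftrightarrow> x \<otimes> x = \<one>"
    using assms by (simp add: numeral_2_eq_2 flip: pow_eq_id)
  also have "\<dots> \<longleftrightarrow> inv x = x"
    using assms by (metis inv_equality r_inv)
  finally show ?thesis .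
qed

theorem proposition3p4:
  fixes G :: "('a, 'b) monoid_scheme" and \<alpha> :: "'a \<Rightarrow> 'a"
  assumes "group G"
    and "\<alpha> \<in> carrier (AutoGroup G)"
    and "inverse_ambiguous G \<alpha>"
  shows "comm_group G \<and>
    \<alpha> [^]\<^bsub>AutoGroup G\<^esub> (4::nat) = \<one>\<^bsub>AutoGroup G\<^esub> \<and>
    (group.ord (AutoGroup G) \<alpha> = 4 \<or>
      ((\<forall>x\<in>carrier G. group.ord G x dvd 2) \<and>
       \<alpha> [^]\<^bsub>AutoGroup G\<^esub> (2::nat) = \<one>\<^bsub>AutoGroup G\<^esub>)) \<and>
    \<not> (group.ord (AutoGroup G) \<alpha> = 4 \<and>
      ((\<forall>x\<in>carrier G. group.ord G x dvd 2) \<and>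
       \<alpha> [^]\<^bsub>AutoGroup G\<^esub> (2::nat) = \<one>\<^bsub>AutoGroup G\<^esub>))"
proof -
  interpret group G
    by (rule assms(1))
  interpret A: group "AutoGroup G"
    by (rule AutoGroup)
  let ?sq = "\<alpha> [^]\<^bsub>AutoGroup G\<^esub> (2::nat)"
  have hom: "\<alpha> \<in> hom G G"
    using assms(2) by (simp add: carrier_AutoGroup)
  have sq: "?sq = (\<lambda>x\<in>carrier G. inv\<^bsub>G\<^esub> x)"
    by (rule AutoGroup_pow2_inverse_ambiguous [OF assms(2,3)])
  have "\<alpha> [^]\<^bsub>AutoGroup G\<^esub> (4::nat) = ?sq \<otimes>\<^bsub>AutoGroup G\<^esub> ?sq"
    using A.nat_pow_mult [OF assms(2), of 2 2] by simp
  also have "\<dots> = compose (carrier G) ?sq ?sq"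
    using assms(2) by (simp add: mult_AutoGroup)
  also have "\<dots> = \<one>\<^bsub>AutoGroup G\<^esub>"
    unfolding sq one_AutoGroup by (auto simp: compose_def)
  finally have pow4: "\<alpha> [^]\<^bsub>AutoGroup G\<^esub> (4::nat) = \<one>\<^bsub>AutoGroup G\<^esub>" .
  have dvd2: "?sq = \<one>\<^bsub>AutoGroup G\<^esub> \<longleftrightarrow> A.ord \<alpha> dvd 2"
    using assms(2) by (rule A.pow_eq_id)
  \<comment> \<open>Writing 4 as a prime power leaves only 1, 2 and 4 as possible orders.\<close>
  have "A.ord \<alpha> dvd 2 ^ 2"
    using A.pow_eq_id [OF assms(2), of 4] pow4 by simp
  then obtain i where i: "i \<le> 2" "A.ord \<alpha> = 2 ^ i"
    using divides_primepow_nat [OF two_is_prime_nat] by blast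
  then have "i = 0 \<or> i = 1 \<or> i = 2"
    by auto
  \<comment> \<open>Among 1, 2 and 4 only 4 does not divide 2. The equivalence yields both that one
    case occurs and that they exclude each other.\<close>
  then have ord4: "A.ord \<alpha> = 4 \<longleftrightarrow> ?sq \<noteq> \<one>\<^bsub>AutoGroup G\<^esub>"
    using i dvd2 by auto
  \<comment> \<open>In case (ii) the condition on \<open>\<alpha>\<close> implies the one on
    elements: evaluate both functions at \<open>x\<close>.\<close>
  have "ord x dvd 2" if "?sq = \<one>\<^bsub>AutoGroup G\<^esub>" and x: "x \<in> carrier G" for x
  proof -
    have "inv\<^bsub>G\<^esub> x = x"
      using fun_cong [OF that(1), of x] x by (simp add: sq one_AutoGroup)
    then show ?thesis
      using x by (simp add: ord_dvd_2_iff_inv_eq)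
  qed
  then show ?thesis
    using inverse_ambiguous_hom_imp_comm_group [OF hom assms(3)] pow4 ord4 by blast
qed

end
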